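(* Let $A,\Omega,B,\Lambda,C,\Gamma,D,\Theta\in\mathcal{C}\otimes\mathcal{A}$ be block columns with first entry $0$, let $\mathbf{A}_0,\mathbf{B}_0,\mathbf{C}_0,\mathbf{D}_0\in\mathcal{D}_n\otimes\mathcal{A}$, and put $\mathbf{A}=\mathbf{T}(A,\Omega)+\mathbf{A}_0$, $\mathbf{B}=\mathbf{T}(B,\Lambda)+\mathbf{B}_0$, $\mathbf{C}=\mathbf{T}(C,\Gamma)+\mathbf{C}_0$, $\mathbf{D}=\mathbf{T}(D,\Theta)+\mathbf{D}_0$. Then: (i) $\mathbf{A}\mathbf{B}-\mathbf{C}\mathbf{D}\in\mathcal{T}_n\otimes\mathcal{A}$, or equivalently $\mathbf{T}(A,\Omega)\mathbf{T}(B,\Lambda)-\mathbf{T}(C,\Gamma)\mathbf{T}(D,\Theta)\in\mathcal{T}_n\otimes\mathcal{A}$, if and only if $$A\Lambda^*-\widetilde{\Omega}\widetilde{B}^*=C\Theta^*-\widetilde{\Gamma}\widetilde{D}^*.$$ (ii) If $\mathbf{A}\mathbf{B}-\mathbf{C}\mathbf{D}\in\mathcal{T}_n\otimes\mathcal{A}$, then $\mathbf{A}\mathbf{B}-\mathbf{C}\mathbf{D}=0$ if and only if both $$\mathbf{A}B+\mathbf{B}_0A+\mathbf{A}_0\mathbf{B}_0P_0^*=\mathbf{C}D+\mathbf{D}_0C+\mathbf{C}_0\mathbf{D}_0P_0^*$$ and $$\mathbf{B}^*\Omega+\mathbf{A}_0^*\Lambda+\mathbf{A}_0^*\mathbf{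B}_0^*P_0^*=\mathbf{D}^*\Gamma+\mathbf{C}_0^*\Theta+\mathbf{C}_0^*\mathbf{D}_0^*P_0^*.$$
   Context: Let $n,d$ be positive integers, $\mathcal{M}_d$ the algebra of complex $d\times d$ matrices, ${}^*$ the conjugate transpose. $\mathcal{A}\subseteq\mathcal{M}_d$ is a fixed commutative subalgebra containing the identity $I$ and closed under ${}^*$. $\mathcal{T}_n\otimes\mathcal{A}$ is the set of $n\times n$ block Toeplitz matrices (blocks constant along diagonals) with blocks in $\mathcal{A}$; $\mathcal{D}_n\otimes\mathcal{A}$ is the set of block diagonal matrices with the same block of $\mathcal{A}$ repeated along the diagonal; $\mathcal{C}\otimes\mathcal{A}$ is the set of $n\times1$ block columns with blocks in $\mathcal{A}$. For block columns $A=(0,A_1,\dots,A_{n-1})^{t}$, $\Omega=(0,\Omega_1,\dots,\Omega_{n-1})^{t}$ (here $t$ only indicates that the blocks are stacked in a column), $\mathbf{T}(A,\Omega)$ is the $n\times n$ block Toeplitz matrix whose $(i,j)$ block is $A_{i-j}$ if $i>j$, $\Omega_{j-i}^*$ if $i<j$, and $0$ if $i=j$; and $\widetilde{A}=(0,A_{n-1}^*,A_{n-2}^*,\dots,A_1^* )^{t}$. $P_0=(I,0,\dots,0)$ is a $1\times n$ block row, so $P_0^*$ is the block column with $I$ first and zeros elsewhere. Products such as $A\Lambda^*$ (an $n\times n$ block matrix) and $\mathbf{A}B$ (a block column) are ordinary block matrix products, where $\Lambda^*$ is the block row of adjoints. *)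

theory Defs
  imports Complex_Main "Jordan_Normal_Form.Schur_Decomposition"
begin

text \<open>
  A \<open>p \<times> q\<close> block matrix with \<open>d \<times> d\<close> blocks is represented by the underlying
  \<open>(p * d) \<times> (q * d)\<close> complex matrix, so that block matrix sums and products and the conjugate
  transpose are the ordinary operations on matrices (\<open>mat_adjoint\<close> being the conjugate
  transpose). Blocks are indexed from 0.
\<close>

definition block :: "nat \<Rightarrow> complex mat \<Rightarrow> nat \<Rightarrow> nat \<Rightarrow> complex mat" where
  "block d M i j = mat d d (\<lambda>(r, s). M $$ (i * d + r, j * d + s))"

definition of_blocks ::
    "nat \<Rightarrow> nat \<Rightarrow> nat \<Rightarrow> (nat \<Rightarrow> nat \<Rightarrow> complex mat) \<Rightarrow> complex mat" where
  "of_blocks p q d F =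
    mat (p * d) (q * d) (\<lambda>(r, s). F (r div d) (s div d) $$ (r mod d, s mod d))"

lemma of_blocks_carrier [simp]: "of_blocks p q d F \<in> carrier_mat (p * d) (q * d)"
  by (simp add: of_blocks_def)

lemma block_of_blocks:
  assumes "i < p" "j < q" "F i j \<in> carrier_mat d d"
  shows "block d (of_blocks p q d F) i j = F i j"
proof (rule eq_matI)
  fix r s assume "r < dim_row (F i j)" "s < dim_col (F i j)"
  then have rs: "r < d" "s < d" using assms(3) by auto
  have bound: "k * d + t < m * d" if "k < m" "t < d" for k m t :: nat
  proof -
    have "k * d + t < Suc k * d" using that by simp
    also have "\<dots> \<le> m * d" using that by (intro mult_le_mono1) simp
    finally show ?thesis .
  qed
  show "block d (of_blocks p q d F) i j $$ (r, s) = F i j $$ (r, s)"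
    using rs bound[OF assms(1) rs(1)] bound[OF assms(2) rs(2)]
    by (simp add: block_def of_blocks_def)
qed (use assms in \<open>auto simp: block_def\<close>)

lemma mat_adjoint_carrier:
  assumes "M \<in> carrier_mat p q"
  shows "mat_adjoint M \<in> carrier_mat q p"
  using assms by (auto simp: mat_adjoint_def)

lemma mat_adjoint_index:
  fixes M :: "complex mat"
  assumes "i < dim_col M" "j < dim_row M"
  shows "mat_adjoint M $$ (i, j) = cnj (M $$ (j, i))"
  using assms by (simp add: mat_adjoint_def mat_of_rows_def)

definition comm_star_subalgebra :: "nat \<Rightarrow> complex mat set \<Rightarrow> bool" where
  "comm_star_subalgebra d \<A> \<longleftrightarrow>
     \<A> \<subseteq> carrier_mat d d \<and>
     1\<^sub>m d \<in> \<A> \<and>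
     (\<forall>X\<in>\<A>. \<forall>Y\<in>\<A>. X + Y \<in> \<A>) \<and>
     (\<forall>c. \<forall>X\<in>\<A>. c \<cdot>\<^sub>m X \<in> \<A>) \<and>
     (\<forall>X\<in>\<A>. \<forall>Y\<in>\<A>. X * Y \<in> \<A>) \<and>
     (\<forall>X\<in>\<A>. \<forall>Y\<in>\<A>. X * Y = Y * X) \<and>
     (\<forall>X\<in>\<A>. mat_adjoint X \<in> \<A>)"

definition block_toeplitz :: "nat \<Rightarrow> nat \<Rightarrow> complex mat set \<Rightarrow> complex mat set" where
  "block_toeplitz n d \<A> =
     {M \<in> carrier_mat (n * d) (n * d).
        (\<forall>i<n. \<forall>j<n. block d M i j \<in> \<A>) \<and>
        (\<forall>i<n. \<forall>j<n. \<forall>k<n. \<forall>l<n.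
           int i - int j = int k - int l \<longrightarrow> block d M i j = block d M k l)}"

definition block_diagonal :: "nat \<Rightarrow> nat \<Rightarrow> complex mat set \<Rightarrow> complex mat set" where
  "block_diagonal n d \<A> =
     {of_blocks n n d (\<lambda>i j. if i = j then X else 0\<^sub>m d d) | X. X \<in> \<A>}"

definition block_columns :: "nat \<Rightarrow> nat \<Rightarrow> complex mat set \<Rightarrow> complex mat set" where
  "block_columns n d \<A> = {X \<in> carrier_mat (n * d) d. \<forall>i<n. block d X i 0 \<in> \<A>}"

definition toep :: "nat \<Rightarrow> nat \<Rightarrow> complex mat \<Rightarrow> complex mat \<Rightarrow> complex mat" where
  "toep n d A \<Omega> = of_blocks n n d (\<lambda>i j.
     if i > j then block d A (i - j) 0
     else if i < j then mat_adjoint (block d \<Omega> (j - i) 0)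
     else 0\<^sub>m d d)"

definition tilde :: "nat \<Rightarrow> nat \<Rightarrow> complex mat \<Rightarrow> complex mat" where
  "tilde n d A = of_blocks n 1 d (\<lambda>i _.
     if i = 0 then 0\<^sub>m d d else mat_adjoint (block d A (n - i) 0))"

definition P0 :: "nat \<Rightarrow> nat \<Rightarrow> complex mat" where
  "P0 n d = of_blocks 1 n d (\<lambda>_ j. if j = 0 then 1\<^sub>m d else 0\<^sub>m d d)"

end

theory Submission
  imports Defs
begin

text \<open>
  If \<open>M\<close> and \<open>N\<close> have blocks \<open>a (i - j)\<close> and \<open>b (i - j)\<close>, then in the sum
  \<open>\<Sum>k<n. a (i - k) * b (k - j)\<close> raising both \<open>i\<close> and \<open>j\<close> by one only shifts \<open>k\<close>, so the
  block \<open>(i + 1, j + 1)\<close> of \<open>M * N\<close> differs from the block \<open>(i, j)\<close> by the two boundary terms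
  \<open>a (i + 1) * b (- (j + 1)) - a (i + 1 - n) * b (n - (j + 1))\<close>. These are the blocks of
  \<open>A \<Lambda>\<^sup>* - \<Omega>\<^sup>~ (B\<^sup>~)\<^sup>*\<close> and do not involve the main diagonals, which gives (i).
  For (ii), a block Toeplitz matrix vanishes iff its first block column and the adjoint of its
  first block row do. The former is obtained by multiplying with \<open>P\<^sub>0\<^sup>*\<close>, and the latter is
  the same computation for the adjoint, where \<open>\<AA>\<^sup>*\<close> arises from \<open>\<AA>\<close> by exchanging \<open>A\<close> and
  \<open>\<Omega>\<close> and replacing \<open>A\<^sub>0\<close> by \<open>A\<^sub>0\<^sup>*\<close>.
\<close>

section \<open>Adjoints\<close>

lemma dim_mat_adjoint [simp]:
  "dim_row (mat_adjoint M) = dim_col M" "dim_col (mat_adjoint M) = dim_row M"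
  by (simp_all add: mat_adjoint_def)

lemma mat_adjoint_mat_adjoint [simp]:
  fixes M :: "complex mat"
  shows "mat_adjoint (mat_adjoint M) = M"
  by (rule eq_matI) (simp_all add: mat_adjoint_index)

lemma mat_adjoint_zero [simp]: "mat_adjoint (0\<^sub>m p q :: complex mat) = 0\<^sub>m q p"
  by (rule eq_matI) (simp_all add: mat_adjoint_index)

lemma mat_adjoint_one [simp]: "mat_adjoint (1\<^sub>m p :: complex mat) = 1\<^sub>m p"
  by (rule eq_matI) (simp_all add: mat_adjoint_index)

lemma mat_adjoint_add:
  fixes M N :: "complex mat"
  assumes "M \<in> carrier_mat p q" "N \<in> carrier_mat p q"
  shows "mat_adjoint (M + N) = mat_adjoint M + mat_adjoint N"
  using assms by (intro eq_matI) (simp_all add: mat_adjoint_index)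

lemma mat_adjoint_minus:
  fixes M N :: "complex mat"
  assumes "M \<in> carrier_mat p q" "N \<in> carrier_mat p q"
  shows "mat_adjoint (M - N) = mat_adjoint M - mat_adjoint N"
  using assms by (intro eq_matI) (simp_all add: mat_adjoint_index)

lemma mat_adjoint_mult:
  fixes M N :: "complex mat"
  assumes "M \<in> carrier_mat p q" "N \<in> carrier_mat q r"
  shows "mat_adjoint (M * N) = mat_adjoint N * mat_adjoint M"
  using assms
  by (intro eq_matI) (simp_all add: mat_adjoint_index scalar_prod_def mult.commute)

lemma minus_mat_eq_zero_iff:
  fixes M N :: "complex mat"
  assumes "M \<in> carrier_mat p q" "N \<in> carrier_mat p q"
  shows "M - N = 0\<^sub>m p q \<longleftrightarrow> M = N"
proof
  assume "M - N = 0\<^sub>m p q"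
  then have "(M - N) $$ (i, j) = 0" if "i < p" "j < q" for i j using that by simp
  then show "M = N" using assms by (intro eq_matI) auto
qed (use assms in auto)

text \<open>Passing to entries turns the equation into one between complex numbers, where the four
  terms can be regrouped freely.\<close>

lemma minus_mat_eq_minus_iff:
  fixes M N K L :: "complex mat"
  assumes "M \<in> carrier_mat p q" "N \<in> carrier_mat p q" "K \<in> carrier_mat p q" "L \<in> carrier_mat p q"
  shows "M - N = K - L \<longleftrightarrow>
    (\<forall>r<p. \<forall>s<q. M $$ (r, s) - N $$ (r, s) = K $$ (r, s) - L $$ (r, s))"
  using assms by (auto simp: mat_eq_iff)

section \<open>Block calculus\<close>

lemma block_index_less:
  fixes i r m d :: nat
  assumes "i < m" "r < d"
  shows "i * d + r < m * d"
proof -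
  have "i * d + r < Suc i * d" using assms by simp
  also have "\<dots> \<le> m * d" using assms by (intro mult_le_mono1) simp
  finally show ?thesis .
qed

lemma block_carrier [simp]: "block d M i j \<in> carrier_mat d d"
  by (simp add: block_def)

lemma dim_block [simp]: "dim_row (block d M i j) = d" "dim_col (block d M i j) = d"
  by (simp_all add: block_def)

lemma block_eqI:
  assumes M: "M \<in> carrier_mat (p * d) (q * d)" and N: "N \<in> carrier_mat (p * d) (q * d)"
    and eq: "\<And>i j. i < p \<Longrightarrow> j < q \<Longrightarrow> block d M i j = block d N i j"
  shows "M = N"
proof (rule eq_matI)
  fix r s assume "r < dim_row N" "s < dim_col N"
  then have rs: "r < p * d" "s < q * d" using N by auto
  \<comment> \<open>An index \<open>r < p * d\<close> can exist only if \<open>d\<close> is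
    positive; this makes \<open>r mod d\<close> and \<open>s mod d\<close> legal positions inside a
    block.\<close>
  then have "d > 0" by (cases d) auto
  have "r div d < p" "s div d < q"
    using rs by (simp_all add: less_mult_imp_div_less)
  then have "block d M (r div d) (s div d) $$ (r mod d, s mod d) =
      block d N (r div d) (s div d) $$ (r mod d, s mod d)"
    using eq by simp
  then show "M $$ (r, s) = N $$ (r, s)"
    using \<open>d > 0\<close> by (simp add: block_def)
qed (use M N in auto)

lemma block_zero:
  assumes "i < p" "j < q"
  shows "block d (0\<^sub>m (p * d) (q * d)) i j = 0\<^sub>m d d"
  using assms by (intro eq_matI) (simp_all add: block_def block_index_less)

lemma block_add:
  assumes "M \<in> carrier_mat (p * d) (q * d)" "N \<in> carrier_mat (p * d) (q * d)" "i < p" "j < q"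
  shows "block d (M + N) i j = block d M i j + block d N i j"
  using assms by (intro eq_matI) (simp_all add: block_def block_index_less)

lemma block_minus:
  assumes "M \<in> carrier_mat (p * d) (q * d)" "N \<in> carrier_mat (p * d) (q * d)" "i < p" "j < q"
  shows "block d (M - N) i j = block d M i j - block d N i j"
  using assms by (intro eq_matI) (simp_all add: block_def block_index_less)

lemma block_mat_adjoint:
  assumes "M \<in> carrier_mat (p * d) (q * d)" "i < p" "j < q"
  shows "block d (mat_adjoint M) j i = mat_adjoint (block d M i j)"
  using assms by (intro eq_matI) (simp_all add: block_def block_index_less mat_adjoint_index)

text \<open>Matrices of all sizes share one type, so a sum has no canonical zero to start from. The
  block size is therefore a parameter and the entries are summed.\<close>

definition sum_mats :: "nat \<Rightarrow> nat \<Rightarrow> (nat \<Rightarrow> complex mat) \<Rightarrow> complex mat" where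
  "sum_mats d n F = mat d d (\<lambda>(r, s). \<Sum>k<n. F k $$ (r, s))"

lemma sum_mats_carrier [simp]: "sum_mats d n F \<in> carrier_mat d d"
  by (simp add: sum_mats_def)

lemma sum_mats_index:
  "r < d \<Longrightarrow> s < d \<Longrightarrow> sum_mats d n F $$ (r, s) = (\<Sum>k<n. F k $$ (r, s))"
  by (simp add: sum_mats_def)

lemma sum_mats_Suc:
  assumes "F n \<in> carrier_mat d d"
  shows "sum_mats d (Suc n) F = sum_mats d n F + F n"
  using assms by (intro eq_matI) (simp_all add: sum_mats_def)

lemma sum_mats_single:
  assumes "m < n" "F m \<in> carrier_mat d d"
    and "\<And>k. k < n \<Longrightarrow> k \<noteq> m \<Longrightarrow> F k = 0\<^sub>m d d"
  shows "sum_mats d n F = F m"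
proof (rule eq_matI)
  fix r s assume "r < dim_row (F m)" "s < dim_col (F m)"
  then have rs: "r < d" "s < d" using assms(2) by auto
  have "(\<Sum>k<n. F k $$ (r, s)) = (\<Sum>k\<in>{m}. F k $$ (r, s))"
    using assms rs by (intro sum.mono_neutral_right) auto
  then show "sum_mats d n F $$ (r, s) = F m $$ (r, s)"
    using rs by (simp add: sum_mats_index)
qed (use assms(2) in \<open>auto simp: sum_mats_def\<close>)

text \<open>The inner index of the scalar product is written uniquely as \<open>k * d + t\<close>
  with \<open>k < m\<close> and \<open>t < d\<close>. For fixed \<open>k\<close>, the sum over
  \<open>t\<close> is an entry of the product of the two \<open>k\<close>-th blocks.\<close>

lemma block_mult:
  assumes M: "M \<in> carrier_mat (p * d) (m * d)" and N: "N \<in> carrier_mat (m * d) (q * d)"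
    and ij: "i < p" "j < q"
  shows "block d (M * N) i j = sum_mats d m (\<lambda>k. block d M i k * block d N k j)"
proof (rule eq_matI)
  fix r s
  assume "r < dim_row (sum_mats d m (\<lambda>k. block d M i k * block d N k j))"
    and "s < dim_col (sum_mats d m (\<lambda>k. block d M i k * block d N k j))"
  then have rs: "r < d" "s < d" by (auto simp: sum_mats_def)
  let ?f = "\<lambda>u. M $$ (i * d + r, u) * N $$ (u, j * d + s)"
  have "block d (M * N) i j $$ (r, s) = (\<Sum>u<m * d. ?f u)"
    using M N ij rs
    by (simp add: block_def block_index_less scalar_prod_def atLeast0LessThan)
  also have "\<dots> = (\<Sum>k<m. \<Sum>u\<in>{k * d..<k * d + d}. ?f u)"
    by (simp add: sum.nat_group)
  also have "\<dots> = (\<Sum>k<m. \<Sum>t<d. ?f (k * d + t))"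
  proof (rule sum.cong [OF refl])
    fix k
    show "(\<Sum>u\<in>{k * d..<k * d + d}. ?f u) = (\<Sum>t<d. ?f (k * d + t))"
      using sum.shift_bounds_nat_ivl [of ?f 0 "k * d" d]
      by (simp add: atLeast0LessThan add.commute)
  qed
  also have "\<dots> = (\<Sum>k<m. (block d M i k * block d N k j) $$ (r, s))"
    using rs by (simp add: block_def scalar_prod_def atLeast0LessThan)
  also have "\<dots> = sum_mats d m (\<lambda>k. block d M i k * block d N k j) $$ (r, s)"
    using rs by (simp add: sum_mats_index)
  finally show "block d (M * N) i j $$ (r, s) =
      sum_mats d m (\<lambda>k. block d M i k * block d N k j) $$ (r, s)" .
qed (simp_all add: sum_mats_def)

section \<open>Block Toeplitz matrices\<close>

lemma comm_star_subalgebraD: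
  assumes "comm_star_subalgebra d \<A>"
  shows "X \<in> \<A> \<Longrightarrow> X \<in> carrier_mat d d"
    and "X \<in> \<A> \<Longrightarrow> Y \<in> \<A> \<Longrightarrow> X * Y \<in> \<A>"
    and "X \<in> \<A> \<Longrightarrow> Y \<in> \<A> \<Longrightarrow> X + Y \<in> \<A>"
    and "X \<in> \<A> \<Longrightarrow> Y \<in> \<A> \<Longrightarrow> X * Y = Y * X"
    and "X \<in> \<A> \<Longrightarrow> mat_adjoint X \<in> \<A>"
  using assms by (auto simp: comm_star_subalgebra_def)

lemma comm_star_subalgebra_zero:
  assumes "comm_star_subalgebra d \<A>"
  shows "0\<^sub>m d d \<in> \<A>"
proof -
  have "0 \<cdot>\<^sub>m 1\<^sub>m d \<in> \<A>" using assms by (simp add: comm_star_subalgebra_def)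
  moreover have "0 \<cdot>\<^sub>m 1\<^sub>m d = (0\<^sub>m d d :: complex mat)" by (intro eq_matI) auto
  ultimately show ?thesis by simp
qed

lemma comm_star_subalgebra_minus:
  assumes \<A>: "comm_star_subalgebra d \<A>" and "X \<in> \<A>" "Y \<in> \<A>"
  shows "X - Y \<in> \<A>"
proof -
  have "X + (-1) \<cdot>\<^sub>m Y \<in> \<A>" using assms by (simp add: comm_star_subalgebra_def)
  moreover have "X + (-1) \<cdot>\<^sub>m Y = X - Y"
    using comm_star_subalgebraD(1) [OF \<A>] assms(2,3) by (intro eq_matI) auto
  ultimately show ?thesis by simp
qed

lemma comm_star_subalgebra_sum_mats:
  assumes "comm_star_subalgebra d \<A>" "\<And>k. k < n \<Longrightarrow> F k \<in> \<A>"
  shows "sum_mats d n F \<in> \<A>"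
  using assms(2)
proof (induction n)
  case 0
  have "sum_mats d 0 F = 0\<^sub>m d d" by (intro eq_matI) (auto simp: sum_mats_def)
  then show ?case using comm_star_subalgebra_zero [OF assms(1)] by simp
next
  case (Suc n)
  then show ?case
    using comm_star_subalgebraD(1,3) [OF assms(1)] by (simp add: sum_mats_Suc)
qed

text \<open>Two positions with the same difference of row and column lie on one diagonal and are
  joined by steps of length one along it, so comparing diagonal neighbours is enough.\<close>

lemma block_toeplitz_iff_shift:
  assumes M: "M \<in> carrier_mat (n * d) (n * d)"
    and \<A>: "\<And>i j. i < n \<Longrightarrow> j < n \<Longrightarrow> block d M i j \<in> \<A>"
  shows "M \<in> block_toeplitz n d \<A> \<longleftrightarrow>
    (\<forall>i j. Suc i < n \<longrightarrow> Suc j < n \<longrightarrow> block d M (Suc i) (Suc j) = block d M i j)"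
    (is "_ \<longleftrightarrow> ?shift")
proof
  assume "M \<in> block_toeplitz n d \<A>"
  then have *: "block d M i j = block d M k l"
    if "i < n" "j < n" "k < n" "l < n" "int i - int j = int k - int l" for i j k l
    using that unfolding block_toeplitz_def by blast
  show ?shift
    by (auto intro!: *)
next
  assume ?shift
  have shift: "block d M (i + m) (j + m) = block d M i j" if "i + m < n" "j + m < n" for i j m
    using that
  proof (induction m)
    case (Suc m)
    then have "block d M (Suc (i + m)) (Suc (j + m)) = block d M (i + m) (j + m)"
      using \<open>?shift\<close> by simp
    with Suc show ?case by simp
  qed simp
  have "block d M i j = block d M k l"
    if "i < n" "j < n" "k < n" "l < n" "int i - int j = int k - int l" for i j k l
  \<comment> \<open>The position with the smaller row index is moved along its diagonal by the
    difference of the row indices.\<close>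
  proof (cases "i \<le> k")
    case True
    with that have "k = i + (k - i)" "l = j + (k - i)" by linarith+
    then show ?thesis using shift [of i "k - i" j] that by simp
  next
    case False
    with that have "i = k + (i - k)" "j = l + (i - k)" by linarith+
    then show ?thesis using shift [of k "i - k" l] that by simp
  qed
  then show "M \<in> block_toeplitz n d \<A>"
    using M \<A> unfolding block_toeplitz_def by blast
qed

text \<open>The diagonals are numbered by integers to avoid truncated subtraction. Only the values
  of \<open>a\<close> strictly between \<open>- n\<close> and \<open>n\<close> are
  constrained.\<close>

definition has_diagonals ::
    "nat \<Rightarrow> nat \<Rightarrow> complex mat set \<Rightarrow> (int \<Rightarrow> complex mat) \<Rightarrow> complex mat \<Rightarrow> bool" where
  "has_diagonals n d \<A> a M \<longleftrightarrow> M \<in> carrier_mat (n * d) (n * d) \<and>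
     (\<forall>i<n. \<forall>j<n. block d M i j = a (int i - int j) \<and> a (int i - int j) \<in> \<A>)"

lemma has_diagonals_mult_shift:
  assumes M: "has_diagonals n d \<A> a M" and N: "has_diagonals n d \<A> b N"
    and ij: "Suc i < n" "Suc j < n" and rs: "r < d" "s < d"
  shows "block d (M * N) (Suc i) (Suc j) $$ (r, s) - block d (M * N) i j $$ (r, s) =
    (a (int i + 1) * b (- int j - 1)) $$ (r, s) -
    (a (int i + 1 - int n) * b (int n - int j - 1)) $$ (r, s)"
proof -
  define f where "f x y = (a x * b y) $$ (r, s)" for x y
  have car: "M \<in> carrier_mat (n * d) (n * d)" "N \<in> carrier_mat (n * d) (n * d)"
    using M N by (auto simp: has_diagonals_def)
  have prod: "block d (M * N) i' j' $$ (r, s) = (\<Sum>k<n. f (int i' - int k) (int k - int j'))"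
    if "i' < n" "j' < n" for i' j'
    using M N that rs
    by (simp add: block_mult [OF car that] sum_mats_index f_def has_diagonals_def)
  \<comment> \<open>With \<open>n = Suc m\<close>, the sum for the block at
    \<open>(Suc i, Suc j)\<close> gives up its term \<open>k = 0\<close>, and the sum for the block
    at \<open>(i, j)\<close> its term \<open>k = m\<close>. The remaining \<open>m\<close> terms
    agree after replacing \<open>k\<close> by \<open>k + 1\<close> in the former, so only these two
    boundary terms survive in the difference.\<close>
  obtain m where m: "n = Suc m" using ij by (cases n) auto
  have "block d (M * N) (Suc i) (Suc j) $$ (r, s) =
      f (int i + 1) (- int j - 1) + (\<Sum>k<m. f (int i - int k) (int k - int j))"
    using ij by (simp add: prod m sum.lessThan_Suc_shift del: sum.lessThan_Suc)
      (simp add: algebra_simps minus_diff_commute)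
  moreover have "block d (M * N) i j $$ (r, s) =
      (\<Sum>k<m. f (int i - int k) (int k - int j)) + f (int i + 1 - int n) (int n - int j - 1)"
    using ij by (simp add: prod m)
  ultimately show ?thesis by (simp add: f_def)
qed

lemma has_diagonals_mult_closed:
  assumes \<A>: "comm_star_subalgebra d \<A>"
    and M: "has_diagonals n d \<A> a M" and N: "has_diagonals n d \<A> b N"
    and ij: "i < n" "j < n"
  shows "block d (M * N) i j \<in> \<A>"
proof -
  have car: "M \<in> carrier_mat (n * d) (n * d)" "N \<in> carrier_mat (n * d) (n * d)"
    using M N by (auto simp: has_diagonals_def)
  show ?thesis
    using M N ij unfolding block_mult [OF car ij]
    by (auto simp: has_diagonals_def
        intro!: comm_star_subalgebra_sum_mats [OF \<A>] comm_star_subalgebraD(2) [OF \<A>])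
qed

text \<open>The blocks of both products lie in \<open>\<A>\<close> automatically, so only shift
  invariance is at stake, and it means that the boundary terms of the two products coincide. For
  \<open>Suc i < n\<close> and \<open>Suc j < n\<close> the four subscripts are nonzero, hence the
  main diagonals do not enter the criterion.\<close>

lemma mult_minus_mult_block_toeplitz_iff:
  assumes \<A>: "comm_star_subalgebra d \<A>"
    and M: "has_diagonals n d \<A> a M" and N: "has_diagonals n d \<A> b N"
    and K: "has_diagonals n d \<A> e K" and L: "has_diagonals n d \<A> f L"
  shows "M * N - K * L \<in> block_toeplitz n d \<A> \<longleftrightarrow>
    (\<forall>i j. Suc i < n \<longrightarrow> Suc j < n \<longrightarrow>
      a (int i + 1) * b (- int j - 1) - a (int i + 1 - int n) * b (int n - int j - 1) =
      e (int i + 1) * f (- int j - 1) - e (int i + 1 - int n) * f (int n - int j - 1))"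
proof -
  have car: "M \<in> carrier_mat (n * d) (n * d)" "N \<in> carrier_mat (n * d) (n * d)"
      "K \<in> carrier_mat (n * d) (n * d)" "L \<in> carrier_mat (n * d) (n * d)"
    using M N K L by (auto simp: has_diagonals_def)
  then have car': "M * N \<in> carrier_mat (n * d) (n * d)" "K * L \<in> carrier_mat (n * d) (n * d)"
    by auto
  have blk: "block d (M * N - K * L) i j = block d (M * N) i j - block d (K * L) i j"
    if "i < n" "j < n" for i j
    using that by (rule block_minus [OF car'])
  have closed: "block d (M * N - K * L) i j \<in> \<A>" if "i < n" "j < n" for i j
    unfolding blk [OF that]
    using that
    by (intro comm_star_subalgebra_minus [OF \<A>] has_diagonals_mult_closed [OF \<A> M N]
        has_diagonals_mult_closed [OF \<A> K L])
  \<comment> \<open>Each of these subscripts is realised by a position of the matrix, namely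
    \<open>(i + 1, 0)\<close>, \<open>(0, j + 1)\<close>, \<open>(i, n - 1)\<close> and
    \<open>(n - 1, j)\<close>, so the coefficient is an element of \<open>\<A>\<close> and has size
    \<open>d\<close>.\<close>
  have coeff: "c (int i + 1) \<in> carrier_mat d d" "c (- int j - 1) \<in> carrier_mat d d"
      "c (int i + 1 - int n) \<in> carrier_mat d d" "c (int n - int j - 1) \<in> carrier_mat d d"
    if "has_diagonals n d \<A> c X" "Suc i < n" "Suc j < n" for c X i j
  proof -
    have *: "c (int k - int l) \<in> carrier_mat d d" if "k < n" "l < n" for k l
      using \<open>has_diagonals n d \<A> c X\<close> that comm_star_subalgebraD(1) [OF \<A>]
      by (auto simp: has_diagonals_def)
    show "c (int i + 1) \<in> carrier_mat d d" "c (- int j - 1) \<in> carrier_mat d d"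
      "c (int i + 1 - int n) \<in> carrier_mat d d" "c (int n - int j - 1) \<in> carrier_mat d d"
      using *[of "Suc i" 0] *[of 0 "Suc j"] *[of i "n - 1"] *[of "n - 1" j] that
      by (simp_all add: of_nat_diff algebra_simps minus_diff_commute)
  qed
  have "block d (M * N - K * L) (Suc i) (Suc j) = block d (M * N - K * L) i j \<longleftrightarrow>
      a (int i + 1) * b (- int j - 1) - a (int i + 1 - int n) * b (int n - int j - 1) =
      e (int i + 1) * f (- int j - 1) - e (int i + 1 - int n) * f (int n - int j - 1)"
    (is "?L \<longleftrightarrow> ?P - ?Q = ?R - ?S") if ij: "Suc i < n" "Suc j < n" for i j
  proof -
    note cs = coeff [OF M ij] coeff [OF N ij] coeff [OF K ij] coeff [OF L ij]
    have cars: "?P \<in> carrier_mat d d" "?Q \<in> carrier_mat d d"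
        "?R \<in> carrier_mat d d" "?S \<in> carrier_mat d d"
      using cs by auto
    have "?L \<longleftrightarrow> (\<forall>r<d. \<forall>s<d.
        block d (M * N) (Suc i) (Suc j) $$ (r, s) - block d (K * L) (Suc i) (Suc j) $$ (r, s) =
        block d (M * N) i j $$ (r, s) - block d (K * L) i j $$ (r, s))"
      using ij by (auto simp: blk mat_eq_iff)
    \<comment> \<open>The four terms are regrouped by product instead of by position, so that the
      shift formula applies to each side separately.\<close>
    also have "\<dots> \<longleftrightarrow> (\<forall>r<d. \<forall>s<d.
        block d (M * N) (Suc i) (Suc j) $$ (r, s) - block d (M * N) i j $$ (r, s) =
        block d (K * L) (Suc i) (Suc j) $$ (r, s) - block d (K * L) i j $$ (r, s))"
      by (simp add: algebra_simps)
    also have "\<dots> \<longleftrightarrow> (\<forall>r<d. \<forall>s<d.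
        ?P $$ (r, s) - ?Q $$ (r, s) = ?R $$ (r, s) - ?S $$ (r, s))"
      using has_diagonals_mult_shift [OF M N ij] has_diagonals_mult_shift [OF K L ij] by simp
    also have "\<dots> \<longleftrightarrow> ?P - ?Q = ?R - ?S"
      by (rule minus_mat_eq_minus_iff [OF cars, symmetric])
    finally show ?thesis .
  qed
  then show ?thesis
    using minus_carrier_mat [OF car'(2)] closed by (subst block_toeplitz_iff_shift) auto
qed

section \<open>Extracting the first block column and the first block row\<close>

lemma P0_carrier: "P0 n d \<in> carrier_mat (1 * d) (n * d)"
  unfolding P0_def by (rule of_blocks_carrier)

lemma mat_adjoint_P0_carrier [simp]: "mat_adjoint (P0 n d) \<in> carrier_mat (n * d) d"
  using mat_adjoint_carrier [OF P0_carrier] by simp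

text \<open>The adjoint of \<open>P0\<close> has the identity on top and zero blocks below, so the
  block sum collapses to its term \<open>k = 0\<close>.\<close>

lemma block_mult_mat_adjoint_P0:
  assumes M: "M \<in> carrier_mat (n * d) (n * d)" and i: "i < n"
  shows "block d (M * mat_adjoint (P0 n d)) i 0 = block d M i 0"
proof -
  have P0: "mat_adjoint (P0 n d) \<in> carrier_mat (n * d) (1 * d)" by simp
  have blk: "block d (mat_adjoint (P0 n d)) k 0 = (if k = 0 then 1\<^sub>m d else 0\<^sub>m d d)"
    if "k < n" for k
  proof -
    have "block d (mat_adjoint (P0 n d)) k 0 = mat_adjoint (block d (P0 n d) 0 k)"
      using that by (intro block_mat_adjoint [OF P0_carrier]) simp_all
    also have "\<dots> = (if k = 0 then 1\<^sub>m d else 0\<^sub>m d d)"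
      using that by (simp add: P0_def block_of_blocks)
    finally show ?thesis .
  qed
  have "block d (M * mat_adjoint (P0 n d)) i 0 =
      sum_mats d n (\<lambda>k. block d M i k * block d (mat_adjoint (P0 n d)) k 0)"
    using block_mult [OF M P0 i] by simp
  also have "\<dots> = block d M i 0 * block d (mat_adjoint (P0 n d)) 0 0"
    using i by (intro sum_mats_single) (auto simp: blk right_mult_zero_mat [OF block_carrier])
  also have "\<dots> = block d M i 0"
    using i by (simp add: blk right_mult_one_mat [OF block_carrier])
  finally show ?thesis .
qed

text \<open>Every diagonal meets the first block column or the first block row, so these two
  determine a block Toeplitz matrix. The row is read off as the first block column of the
  adjoint.\<close>

lemma block_toeplitz_eq_zero_iff:
  assumes "M \<in> block_toeplitz n d \<A>"
  shows "M = 0\<^sub>m (n * d) (n * d) \<longleftrightarrow>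
    M * mat_adjoint (P0 n d) = 0\<^sub>m (n * d) d \<and>
    mat_adjoint M * mat_adjoint (P0 n d) = 0\<^sub>m (n * d) d"
proof
  assume "M = 0\<^sub>m (n * d) (n * d)"
  then show "M * mat_adjoint (P0 n d) = 0\<^sub>m (n * d) d \<and>
      mat_adjoint M * mat_adjoint (P0 n d) = 0\<^sub>m (n * d) d"
    using left_mult_zero_mat [OF mat_adjoint_P0_carrier, of "n * d" n d] by simp
next
  assume 0: "M * mat_adjoint (P0 n d) = 0\<^sub>m (n * d) d \<and>
    mat_adjoint M * mat_adjoint (P0 n d) = 0\<^sub>m (n * d) d"
  have M: "M \<in> carrier_mat (n * d) (n * d)"
    and eq: "\<And>i j k l. i < n \<Longrightarrow> j < n \<Longrightarrow> k < n \<Longrightarrow> l < n \<Longrightarrow>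
      int i - int j = int k - int l \<Longrightarrow> block d M i j = block d M k l"
    using assms unfolding block_toeplitz_def by blast+
  have zero: "block d (0\<^sub>m (n * d) d) i 0 = 0\<^sub>m d d" if "i < n" for i
    using block_zero [of i n 0 1 d] that by simp
  have col: "block d M i 0 = 0\<^sub>m d d" if "i < n" for i
    using block_mult_mat_adjoint_P0 [OF M that] 0 zero [OF that] by simp
  have row: "block d M 0 j = 0\<^sub>m d d" if "j < n" for j
  proof -
    have "mat_adjoint (block d M 0 j) = 0\<^sub>m d d"
      using block_mult_mat_adjoint_P0 [OF mat_adjoint_carrier [OF M] that]
        block_mat_adjoint [OF M, of 0 j] 0 zero [OF that] that by simp
    then show ?thesis by (metis mat_adjoint_mat_adjoint mat_adjoint_zero)
  qed
  show "M = 0\<^sub>m (n * d) (n * d)"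
  proof (rule block_eqI [OF M])
    fix i j assume ij: "i < n" "j < n"
    have "block d M i j = 0\<^sub>m d d"
    proof (cases "j \<le> i")
      case True
      then show ?thesis using eq [of i j "i - j" 0] col ij by simp
    next
      case False
      then show ?thesis using eq [of i j 0 "j - i"] row ij by simp
    qed
    then show "block d M i j = block d (0\<^sub>m (n * d) (n * d)) i j"
      using ij by (simp add: block_zero)
  qed simp
qed

section \<open>The matrices \<open>T(A, \<Omega>) + A\<^sub>0\<close>\<close>

text \<open>The separate value \<open>X\<close> on diagonal 0 lets one definition serve both
  \<open>toep n d A \<Omega>\<close>, where \<open>X\<close> is zero, and its sum with a block
  diagonal matrix.\<close>

definition diagonals ::
    "nat \<Rightarrow> complex mat \<Rightarrow> complex mat \<Rightarrow> complex mat \<Rightarrow> int \<Rightarrow> complex mat" where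
  "diagonals d A \<Omega> X z =
     (if z > 0 then block d A (nat z) 0
      else if z < 0 then mat_adjoint (block d \<Omega> (nat (- z)) 0) else X)"

lemma toep_carrier [simp]: "toep n d A \<Omega> \<in> carrier_mat (n * d) (n * d)"
  by (simp add: toep_def)

lemma block_toep:
  assumes "i < n" "j < n"
  shows "block d (toep n d A \<Omega>) i j = diagonals d A \<Omega> (0\<^sub>m d d) (int i - int j)"
proof -
  have "nat (int i - int j) = i - j" "nat (- (int i - int j)) = j - i" by auto
  then show ?thesis
    unfolding toep_def using assms
    by (subst block_of_blocks) (auto simp: diagonals_def intro: mat_adjoint_carrier)
qed

lemma tilde_carrier [simp]: "tilde n d A \<in> carrier_mat (n * d) d"
  using of_blocks_carrier [of n 1 d] by (simp add: tilde_def)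

lemma block_tilde:
  assumes "i < n"
  shows "block d (tilde n d A) i 0 =
    (if i = 0 then 0\<^sub>m d d else mat_adjoint (block d A (n - i) 0))"
  unfolding tilde_def using assms
  by (subst block_of_blocks) (auto intro: mat_adjoint_carrier)

section \<open>Block diagonal matrices with a repeated block\<close>

lemma block_diagonal_iff:
  assumes "comm_star_subalgebra d \<A>"
  shows "M \<in> block_diagonal n d \<A> \<longleftrightarrow> M \<in> carrier_mat (n * d) (n * d) \<and>
    (\<exists>X\<in>\<A>. \<forall>i<n. \<forall>j<n. block d M i j = (if i = j then X else 0\<^sub>m d d))"
proof -
  have blk: "block d (of_blocks n n d (\<lambda>i j. if i = j then X else 0\<^sub>m d d)) i j =
      (if i = j then X else 0\<^sub>m d d)" if "X \<in> \<A>" "i < n" "j < n" for X i j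
    using that comm_star_subalgebraD(1) [OF assms] by (subst block_of_blocks) auto
  show ?thesis
  proof
    assume "M \<in> block_diagonal n d \<A>"
    then obtain X where X: "X \<in> \<A>" "M = of_blocks n n d (\<lambda>i j. if i = j then X else 0\<^sub>m d d)"
      unfolding block_diagonal_def by blast
    then show "M \<in> carrier_mat (n * d) (n * d) \<and>
        (\<exists>X\<in>\<A>. \<forall>i<n. \<forall>j<n. block d M i j = (if i = j then X else 0\<^sub>m d d))"
      using X(1) by (auto simp: X(2) blk [OF X(1)] intro!: bexI [of _ X])
  next
    assume M: "M \<in> carrier_mat (n * d) (n * d) \<and>
      (\<exists>X\<in>\<A>. \<forall>i<n. \<forall>j<n. block d M i j = (if i = j then X else 0\<^sub>m d d))"
    then obtain X where X: "X \<in> \<A>"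
      "\<And>i j. i < n \<Longrightarrow> j < n \<Longrightarrow> block d M i j = (if i = j then X else 0\<^sub>m d d)" by blast
    have "M = of_blocks n n d (\<lambda>i j. if i = j then X else 0\<^sub>m d d)"
    proof (rule block_eqI)
      show "M \<in> carrier_mat (n * d) (n * d)" using M by blast
      show "of_blocks n n d (\<lambda>i j. if i = j then X else 0\<^sub>m d d) \<in> carrier_mat (n * d) (n * d)"
        by simp
    qed (simp only: X blk [OF X(1)])
    then show "M \<in> block_diagonal n d \<A>" using X unfolding block_diagonal_def by blast
  qed
qed

lemma mat_adjoint_block_diagonal:
  assumes "comm_star_subalgebra d \<A>" "M \<in> block_diagonal n d \<A>"
  shows "mat_adjoint M \<in> block_diagonal n d \<A>"
proof -
  obtain X where M: "M \<in> carrier_mat (n * d) (n * d)" and X: "X \<in> \<A>"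
      "\<And>i j. i < n \<Longrightarrow> j < n \<Longrightarrow> block d M i j = (if i = j then X else 0\<^sub>m d d)"
    using assms(2) by (auto simp: block_diagonal_iff [OF assms(1)])
  have "block d (mat_adjoint M) i j = (if i = j then mat_adjoint X else 0\<^sub>m d d)"
    if "i < n" "j < n" for i j
    using that X by (simp add: block_mat_adjoint [OF M])
  then show ?thesis
    unfolding block_diagonal_iff [OF assms(1)]
    using comm_star_subalgebraD(5) [OF assms(1) X(1)] mat_adjoint_carrier [OF M] by blast
qed

text \<open>If \<open>X\<close> is the repeated block of \<open>D\<close>, multiplying by
  \<open>D\<close> on the left or on the right multiplies each block of \<open>M\<close> by
  \<open>X\<close> on that side. Commutativity of \<open>\<A>\<close> is used through this
  lemma.\<close>

lemma block_diagonal_commute: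
  assumes \<A>: "comm_star_subalgebra d \<A>" and D: "D \<in> block_diagonal n d \<A>"
    and M: "M \<in> carrier_mat (n * d) (n * d)"
    and blk: "\<And>i j. i < n \<Longrightarrow> j < n \<Longrightarrow> block d M i j \<in> \<A>"
  shows "D * M = M * D"
proof -
  obtain X where D': "D \<in> carrier_mat (n * d) (n * d)" and X: "X \<in> \<A>"
      "\<And>i j. i < n \<Longrightarrow> j < n \<Longrightarrow> block d D i j = (if i = j then X else 0\<^sub>m d d)"
    using D by (auto simp: block_diagonal_iff [OF \<A>])
  have Xc: "X \<in> carrier_mat d d" using X(1) by (rule comm_star_subalgebraD(1) [OF \<A>])
  show ?thesis
  proof (rule block_eqI [where p = n and q = n and d = d])
    fix i j assume ij: "i < n" "j < n"
    have "block d (D * M) i j = X * block d M i j"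
      unfolding block_mult [OF D' M ij]
      using ij X Xc left_mult_zero_mat [OF block_carrier]
      by (subst sum_mats_single [of i]) auto
    moreover have "block d (M * D) i j = block d M i j * X"
      unfolding block_mult [OF M D' ij]
      using ij X Xc right_mult_zero_mat [OF block_carrier]
      by (subst sum_mats_single [of j]) auto
    ultimately show "block d (D * M) i j = block d (M * D) i j"
      using comm_star_subalgebraD(4) [OF \<A> X(1) blk [OF ij]] by simp
  qed (use D' M in auto)
qed

lemma diagonals_closed:
  assumes "comm_star_subalgebra d \<A>" "A \<in> block_columns n d \<A>" "\<Omega> \<in> block_columns n d \<A>"
    and "X \<in> \<A>" "i < n" "j < n"
  shows "diagonals d A \<Omega> X (int i - int j) \<in> \<A>"
proof -
  have "nat (int i - int j) < n" "nat (- (int i - int j)) < n" using assms(5,6) by linarith+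
  then show ?thesis
    using assms(2-4) comm_star_subalgebraD(5) [OF assms(1)]
    by (auto simp: diagonals_def block_columns_def)
qed

lemma has_diagonals_toep:
  assumes "comm_star_subalgebra d \<A>" "A \<in> block_columns n d \<A>" "\<Omega> \<in> block_columns n d \<A>"
  shows "has_diagonals n d \<A> (diagonals d A \<Omega> (0\<^sub>m d d)) (toep n d A \<Omega>)"
  using assms
  by (auto simp: has_diagonals_def block_toep comm_star_subalgebra_zero intro!: diagonals_closed)

text \<open>\<open>X\<close> is the repeated block of \<open>D\<close>. Its mere existence suffices
  later, because the displacement formula holds for every value on diagonal 0.\<close>

lemma has_diagonals_toep_add:
  assumes \<A>: "comm_star_subalgebra d \<A>"
    and cols: "A \<in> block_columns n d \<A>" "\<Omega> \<in> block_columns n d \<A>"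
    and D: "D \<in> block_diagonal n d \<A>"
  obtains X where "has_diagonals n d \<A> (diagonals d A \<Omega> X) (toep n d A \<Omega> + D)"
proof -
  obtain X where D': "D \<in> carrier_mat (n * d) (n * d)" and X: "X \<in> \<A>"
      "\<And>i j. i < n \<Longrightarrow> j < n \<Longrightarrow> block d D i j = (if i = j then X else 0\<^sub>m d d)"
    using D by (auto simp: block_diagonal_iff [OF \<A>])
  have Xc: "X \<in> carrier_mat d d" using X(1) by (rule comm_star_subalgebraD(1) [OF \<A>])
  have "block d (toep n d A \<Omega> + D) i j = diagonals d A \<Omega> X (int i - int j)"
    if "i < n" "j < n" for i j
    using that X Xc
    by (auto simp: block_add [OF toep_carrier D'] block_toep diagonals_def
        mat_adjoint_carrier [OF block_carrier] right_add_zero_mat [OF block_carrier]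
        right_add_zero_mat [OF mat_adjoint_carrier [OF block_carrier]])
  then have "has_diagonals n d \<A> (diagonals d A \<Omega> X) (toep n d A \<Omega> + D)"
    using D' X(1) diagonals_closed [OF \<A> cols X(1)] by (auto simp: has_diagonals_def)
  then show thesis by (rule that)
qed

section \<open>Adjoints and first block columns of products\<close>

lemma mat_adjoint_toep: "mat_adjoint (toep n d A \<Omega>) = toep n d \<Omega> A"
proof (rule block_eqI [where p = n and q = n and d = d])
  fix i j assume ij: "i < n" "j < n"
  have "nat (int i - int j) = i - j" "nat (int j - int i) = j - i" by auto
  then show "block d (mat_adjoint (toep n d A \<Omega>)) i j = block d (toep n d \<Omega> A) i j"
    using ij by (simp add: block_mat_adjoint [OF toep_carrier] block_toep diagonals_def)
qed (auto intro: mat_adjoint_carrier)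

text \<open>Below its top block, the first block column of \<open>toep n d A \<Omega>\<close> is
  that of \<open>A\<close>. The top block lies on the zero main diagonal, which agrees with
  \<open>A\<close> because the first block of \<open>A\<close> is zero.\<close>

lemma toep_mult_mat_adjoint_P0:
  assumes A: "A \<in> carrier_mat (n * d) d" "block d A 0 0 = 0\<^sub>m d d"
  shows "toep n d A \<Omega> * mat_adjoint (P0 n d) = A"
proof (rule block_eqI [where p = n and q = 1 and d = d])
  fix i j :: nat assume ij: "i < n" "j < 1"
  then show "block d (toep n d A \<Omega> * mat_adjoint (P0 n d)) i j = block d A i j"
    using A by (auto simp: block_mult_mat_adjoint_P0 block_toep diagonals_def)
qed (use A in \<open>auto intro: mult_carrier_mat [OF toep_carrier]\<close>)

text \<open>Applying the second factor to the adjoint of \<open>P0\<close> first gives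
  \<open>B\<close> plus the first block column of \<open>E\<close>. When the first factor is
  expanded on the latter, \<open>toep n d A \<Omega>\<close> is moved past \<open>E\<close>, which
  commutes with it, and then yields \<open>A\<close>; this is the origin of
  \<open>E * A\<close>.\<close>

lemma first_column_mult:
  assumes \<A>: "comm_star_subalgebra d \<A>"
    and cols: "A \<in> block_columns n d \<A>" "\<Omega> \<in> block_columns n d \<A>" "B \<in> block_columns n d \<A>"
    and 0: "block d A 0 0 = 0\<^sub>m d d" "block d B 0 0 = 0\<^sub>m d d"
    and diag: "D \<in> block_diagonal n d \<A>" "E \<in> block_diagonal n d \<A>"
  shows "(toep n d A \<Omega> + D) * (toep n d B \<Lambda> + E) * mat_adjoint (P0 n d) =
    (toep n d A \<Omega> + D) * B + E * A + D * E * mat_adjoint (P0 n d)"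
proof -
  let ?P = "mat_adjoint (P0 n d)" and ?T = "toep n d A \<Omega>"
  have car: "D \<in> carrier_mat (n * d) (n * d)" "E \<in> carrier_mat (n * d) (n * d)"
      "A \<in> carrier_mat (n * d) d" "B \<in> carrier_mat (n * d) d"
      "?T \<in> carrier_mat (n * d) (n * d)" "?P \<in> carrier_mat (n * d) d"
    using cols diag by (auto simp: block_columns_def block_diagonal_def)
  then have car': "?T + D \<in> carrier_mat (n * d) (n * d)" "E * ?P \<in> carrier_mat (n * d) d"
    by auto
  have "(?T + D) * (toep n d B \<Lambda> + E) * ?P = (?T + D) * ((toep n d B \<Lambda> + E) * ?P)"
    using car(2) by (intro assoc_mult_mat [OF car'(1) _ car(6)]) auto
  also have "(toep n d B \<Lambda> + E) * ?P = B + E * ?P"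
    using car 0 by (simp add: add_mult_distrib_mat [OF toep_carrier car(2,6)] toep_mult_mat_adjoint_P0)
  also have "(?T + D) * (B + E * ?P) = (?T + D) * B + (?T + D) * (E * ?P)"
    by (rule mult_add_distrib_mat [OF car'(1) car(4) car'(2)])
  also have "(?T + D) * (E * ?P) = ?T * (E * ?P) + D * (E * ?P)"
    by (rule add_mult_distrib_mat [OF car(5,1) car'(2)])
  also have "?T * (E * ?P) = ?T * E * ?P"
    by (rule assoc_mult_mat [OF car(5,2,6), symmetric])
  also have "?T * E = E * ?T"
    using cols
    by (intro block_diagonal_commute [OF \<A> diag(2) toep_carrier, symmetric])
      (auto simp: block_toep comm_star_subalgebra_zero [OF \<A>] intro!: diagonals_closed [OF \<A>])
  also have "E * ?T * ?P = E * (?T * ?P)"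
    by (rule assoc_mult_mat [OF car(2,5,6)])
  also have "?T * ?P = A"
    using car 0 by (simp add: toep_mult_mat_adjoint_P0)
  also have "D * (E * ?P) = D * E * ?P"
    by (rule assoc_mult_mat [OF car(1,2,6), symmetric])
  also have "(?T + D) * B + (E * A + D * E * ?P) = (?T + D) * B + E * A + D * E * ?P"
    by (rule assoc_add_mat [symmetric])
      (rule mult_carrier_mat [OF car'(1) car(4)] mult_carrier_mat [OF car(2,3)]
        mult_carrier_mat [OF mult_carrier_mat [OF car(1,2)] car(6)])+
  finally show ?thesis .
qed

text \<open>The adjoint reverses the product and again gives factors of the form treated in
  \<open>first_column_mult\<close>, now with columns \<Lambda>, \<open>B\<close> in the first factor
  and \<Omega>, \<open>A\<close> in the second. The adjoints of \<open>E\<close> and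
  \<open>D\<close> then come out in this order and are swapped by commutativity.\<close>

lemma first_row_mult:
  assumes \<A>: "comm_star_subalgebra d \<A>"
    and cols: "\<Omega> \<in> block_columns n d \<A>" "B \<in> block_columns n d \<A>" "\<Lambda> \<in> block_columns n d \<A>"
    and 0: "block d \<Omega> 0 0 = 0\<^sub>m d d" "block d \<Lambda> 0 0 = 0\<^sub>m d d"
    and diag: "D \<in> block_diagonal n d \<A>" "E \<in> block_diagonal n d \<A>"
  shows "mat_adjoint ((toep n d A \<Omega> + D) * (toep n d B \<Lambda> + E)) * mat_adjoint (P0 n d) =
    mat_adjoint (toep n d B \<Lambda> + E) * \<Omega> + mat_adjoint D * \<Lambda>
      + mat_adjoint D * mat_adjoint E * mat_adjoint (P0 n d)"
proof -
  have car: "D \<in> carrier_mat (n * d) (n * d)" "E \<in> carrier_mat (n * d) (n * d)"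
    using diag by (auto simp: block_diagonal_def)
  note adj = mat_adjoint_block_diagonal [OF \<A>]
  have "block d (mat_adjoint E) i j \<in> \<A>" if "i < n" "j < n" for i j
    using adj [OF diag(2)] that comm_star_subalgebra_zero [OF \<A>]
    by (auto simp: block_diagonal_iff [OF \<A>])
  then have "mat_adjoint D * mat_adjoint E = mat_adjoint E * mat_adjoint D"
    using car by (intro block_diagonal_commute [OF \<A> adj [OF diag(1)]] mat_adjoint_carrier) auto
  moreover have "mat_adjoint (toep n d A \<Omega> + D) = toep n d \<Omega> A + mat_adjoint D"
      "mat_adjoint (toep n d B \<Lambda> + E) = toep n d \<Lambda> B + mat_adjoint E"
    using car by (simp_all add: mat_adjoint_add [OF toep_carrier] mat_adjoint_toep)
  moreover have "mat_adjoint ((toep n d A \<Omega> + D) * (toep n d B \<Lambda> + E)) =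
      mat_adjoint (toep n d B \<Lambda> + E) * mat_adjoint (toep n d A \<Omega> + D)"
    using car by (intro mat_adjoint_mult) auto
  ultimately show ?thesis
    using first_column_mult [OF \<A> cols(3,2,1) 0(2,1) adj [OF diag(2)] adj [OF diag(1)], of A]
    by simp
qed

section \<open>The displacement matrices in the criterion (i)\<close>

lemma block_column_mult_mat_adjoint:
  assumes "X \<in> carrier_mat (n * d) d" "Y \<in> carrier_mat (n * d) d" "i < n" "j < n"
  shows "block d (X * mat_adjoint Y) i j = block d X i 0 * mat_adjoint (block d Y j 0)"
proof -
  have Y: "Y \<in> carrier_mat (n * d) (1 * d)" using assms by simp
  have "block d (X * mat_adjoint Y) i j =
      sum_mats d 1 (\<lambda>k. block d X i k * block d (mat_adjoint Y) k j)"
    using assms mat_adjoint_carrier [OF Y] by (intro block_mult) auto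
  \<comment> \<open>A block column times a block row has inner block dimension 1, so the sum has a
    single term.\<close>
  also have "\<dots> = block d X i 0 * block d (mat_adjoint Y) 0 j"
    by (rule sum_mats_single) (auto intro: mult_carrier_mat)
  finally show ?thesis using assms by (simp add: block_mat_adjoint [OF Y])
qed

text \<open>All four columns start with a zero block, so block row 0 and block column 0 vanish.
  Elsewhere the reversal in \<open>tilde\<close> turns block \<open>i\<close> of
  \<open>tilde n d \<Omega>\<close> into diagonal \<open>i - n\<close>, and the adjoint of block
  \<open>j\<close> of \<open>tilde n d B\<close> into diagonal \<open>n - j\<close>. No subscript is
  0 there, so \<open>X\<close> and \<open>Y\<close> are free.\<close>

lemma block_displacement:
  assumes A: "A \<in> carrier_mat (n * d) d" "block d A 0 0 = 0\<^sub>m d d"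
    and \<Lambda>: "\<Lambda> \<in> carrier_mat (n * d) d" "block d \<Lambda> 0 0 = 0\<^sub>m d d"
    and ij: "i < n" "j < n"
  shows "block d (A * mat_adjoint \<Lambda> - tilde n d \<Omega> * mat_adjoint (tilde n d B)) i j =
    (if i = 0 \<or> j = 0 then 0\<^sub>m d d else
      diagonals d A \<Omega> X (int i) * diagonals d B \<Lambda> Y (- int j) -
      diagonals d A \<Omega> X (int i - int n) * diagonals d B \<Lambda> Y (int n - int j))"
proof -
  have "nat (int n - int i) = n - i" "nat (int n - int j) = n - j" by auto
  moreover have "A * mat_adjoint \<Lambda> \<in> carrier_mat (n * d) (n * d)"
    "tilde n d \<Omega> * mat_adjoint (tilde n d B) \<in> carrier_mat (n * d) (n * d)"
    by (rule mult_carrier_mat [OF A(1) mat_adjoint_carrier [OF \<Lambda>(1)]]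
        mult_carrier_mat [OF tilde_carrier mat_adjoint_carrier [OF tilde_carrier]])+
  ultimately show ?thesis
    using A \<Lambda> ij
    by (auto simp: block_minus block_column_mult_mat_adjoint
        block_column_mult_mat_adjoint [OF tilde_carrier tilde_carrier] block_tilde diagonals_def
        left_mult_zero_mat [OF block_carrier] right_mult_zero_mat [OF block_carrier]
        left_mult_zero_mat [OF mat_adjoint_carrier [OF block_carrier]]
        right_mult_zero_mat [OF mat_adjoint_carrier [OF block_carrier]])
qed

text \<open>Since block row 0 and block column 0 vanish on both sides, only positions
  \<open>(Suc i, Suc j)\<close> have to be compared; this shift by one produces exactly the boundary
  terms of the product criterion. The values \<open>W\<close>, \<open>X\<close>, \<open>Y\<close>,
  \<open>Z\<close> on diagonal 0 are arbitrary.\<close>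

lemma displacement_eq_iff:
  assumes A: "A \<in> carrier_mat (n * d) d" "block d A 0 0 = 0\<^sub>m d d"
    and \<Lambda>: "\<Lambda> \<in> carrier_mat (n * d) d" "block d \<Lambda> 0 0 = 0\<^sub>m d d"
    and C: "C \<in> carrier_mat (n * d) d" "block d C 0 0 = 0\<^sub>m d d"
    and \<Theta>: "\<Theta> \<in> carrier_mat (n * d) d" "block d \<Theta> 0 0 = 0\<^sub>m d d"
  shows "A * mat_adjoint \<Lambda> - tilde n d \<Omega> * mat_adjoint (tilde n d B) =
      C * mat_adjoint \<Theta> - tilde n d \<Gamma> * mat_adjoint (tilde n d D) \<longleftrightarrow>
    (\<forall>i j. Suc i < n \<longrightarrow> Suc j < n \<longrightarrow>
      diagonals d A \<Omega> W (int i + 1) * diagonals d B \<Lambda> X (- int j - 1) -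
      diagonals d A \<Omega> W (int i + 1 - int n) * diagonals d B \<Lambda> X (int n - int j - 1) =
      diagonals d C \<Gamma> Y (int i + 1) * diagonals d D \<Theta> Z (- int j - 1) -
      diagonals d C \<Gamma> Y (int i + 1 - int n) * diagonals d D \<Theta> Z (int n - int j - 1))"
    (is "?M = ?N \<longleftrightarrow> ?R")
proof -
  note blks = block_displacement [OF A \<Lambda>, where X = W and Y = X]
    block_displacement [OF C \<Theta>, where X = Y and Y = Z]
  have arith: "int (Suc i) = int i + 1" "- (int j + 1) = - int j - 1"
    "int n - (int j + 1) = int n - int j - 1" for i j by auto
  have car: "?M \<in> carrier_mat (n * d) (n * d)" "?N \<in> carrier_mat (n * d) (n * d)"
    by (intro minus_carrier_mat mult_carrier_mat [OF tilde_carrier] mat_adjoint_carrier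
        tilde_carrier)+
  show ?thesis
  proof
    assume eq: "?M = ?N"
    show ?R
    proof (intro allI impI)
      fix i j assume ij: "Suc i < n" "Suc j < n"
      have "block d ?M (Suc i) (Suc j) = block d ?N (Suc i) (Suc j)" using eq by simp
      then show "diagonals d A \<Omega> W (int i + 1) * diagonals d B \<Lambda> X (- int j - 1) -
          diagonals d A \<Omega> W (int i + 1 - int n) * diagonals d B \<Lambda> X (int n - int j - 1) =
          diagonals d C \<Gamma> Y (int i + 1) * diagonals d D \<Theta> Z (- int j - 1) -
          diagonals d C \<Gamma> Y (int i + 1 - int n) * diagonals d D \<Theta> Z (int n - int j - 1)"
        unfolding blks(1) [OF ij] blks(2) [OF ij] arith by simp
    qed
  next
    assume R: ?R
    show "?M = ?N"
    proof (rule block_eqI [OF car])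
      fix i j assume ij: "i < n" "j < n"
      show "block d ?M i j = block d ?N i j"
      proof (cases "i = 0 \<or> j = 0")
        case True
        then show ?thesis by (simp only: blks [OF ij] if_True)
      next
        case False
        then obtain i' j' where Suc: "i = Suc i'" "j = Suc j'" by (metis not0_implies_Suc)
        show ?thesis
          using R [rule_format, of i' j'] ij unfolding blks [OF ij] unfolding Suc arith by simp
      qed
    qed
  qed
qed

theorem theorem3p2:
  fixes n d :: nat
    and \<A> :: "complex mat set"
    and A \<Omega> B \<Lambda> C \<Gamma> D \<Theta> :: "complex mat"
    and A\<^sub>0 B\<^sub>0 C\<^sub>0 D\<^sub>0 \<AA> \<BB> \<CC> \<DD> :: "complex mat"
  assumes "n > 0" and "d > 0"
    and "comm_star_subalgebra d \<A>"
    and "{A, \<Omega>, B, \<Lambda>, C, \<Gamma>, D, \<Theta>} \<subseteq> block_columns n d \<A>"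
    and "\<forall>X \<in> {A, \<Omega>, B, \<Lambda>, C, \<Gamma>, D, \<Theta>}. block d X 0 0 = 0\<^sub>m d d"
    and "{A\<^sub>0, B\<^sub>0, C\<^sub>0, D\<^sub>0} \<subseteq> block_diagonal n d \<A>"
    and "\<AA> = toep n d A \<Omega> + A\<^sub>0"
    and "\<BB> = toep n d B \<Lambda> + B\<^sub>0"
    and "\<CC> = toep n d C \<Gamma> + C\<^sub>0"
    and "\<DD> = toep n d D \<Theta> + D\<^sub>0"
  shows
    "(\<AA> * \<BB> - \<CC> * \<DD> \<in> block_toeplitz n d \<A> \<longleftrightarrow>
        toep n d A \<Omega> * toep n d B \<Lambda> - toep n d C \<Gamma> * toep n d D \<Theta> \<in> block_toeplitz n d \<A>) \<and>
     (\<AA> * \<BB> - \<CC> * \<DD> \<in> block_toeplitz n d \<A> \<longleftrightarrow>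
        A * mat_adjoint \<Lambda> - tilde n d \<Omega> * mat_adjoint (tilde n d B) =
        C * mat_adjoint \<Theta> - tilde n d \<Gamma> * mat_adjoint (tilde n d D)) \<and>
     (\<AA> * \<BB> - \<CC> * \<DD> \<in> block_toeplitz n d \<A> \<longrightarrow>
        (\<AA> * \<BB> - \<CC> * \<DD> = 0\<^sub>m (n * d) (n * d) \<longleftrightarrow>
           \<AA> * B + B\<^sub>0 * A + A\<^sub>0 * B\<^sub>0 * mat_adjoint (P0 n d) =
           \<CC> * D + D\<^sub>0 * C + C\<^sub>0 * D\<^sub>0 * mat_adjoint (P0 n d) \<and>
           mat_adjoint \<BB> * \<Omega> + mat_adjoint A\<^sub>0 * \<Lambda>
             + mat_adjoint A\<^sub>0 * mat_adjoint B\<^sub>0 * mat_adjoint (P0 n d) =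
           mat_adjoint \<DD> * \<Gamma> + mat_adjoint C\<^sub>0 * \<Theta>
             + mat_adjoint C\<^sub>0 * mat_adjoint D\<^sub>0 * mat_adjoint (P0 n d)))"
proof -
  note \<A> = assms(3)
  have cols: "A \<in> block_columns n d \<A>" "\<Omega> \<in> block_columns n d \<A>"
      "B \<in> block_columns n d \<A>" "\<Lambda> \<in> block_columns n d \<A>"
      "C \<in> block_columns n d \<A>" "\<Gamma> \<in> block_columns n d \<A>"
      "D \<in> block_columns n d \<A>" "\<Theta> \<in> block_columns n d \<A>"
    using assms(4) by auto
  have diag: "A\<^sub>0 \<in> block_diagonal n d \<A>" "B\<^sub>0 \<in> block_diagonal n d \<A>"
      "C\<^sub>0 \<in> block_diagonal n d \<A>" "D\<^sub>0 \<in> block_diagonal n d \<A>"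
    using assms(6) by auto
  have zero: "block d A 0 0 = 0\<^sub>m d d" "block d \<Omega> 0 0 = 0\<^sub>m d d"
      "block d B 0 0 = 0\<^sub>m d d" "block d \<Lambda> 0 0 = 0\<^sub>m d d"
      "block d C 0 0 = 0\<^sub>m d d" "block d \<Gamma> 0 0 = 0\<^sub>m d d"
      "block d D 0 0 = 0\<^sub>m d d" "block d \<Theta> 0 0 = 0\<^sub>m d d"
    using assms(5) by auto
  have colc: "X \<in> carrier_mat (n * d) d" if "X \<in> block_columns n d \<A>" for X
    using that by (simp add: block_columns_def)
  have diagc: "X \<in> carrier_mat (n * d) (n * d)" if "X \<in> block_diagonal n d \<A>" for X
    using that by (auto simp: block_diagonal_def)
  \<comment> \<open>The left side of this equivalence does not mention the main diagonals.
    Instantiating them once with zero and once with the repeated blocks of \<open>A\<^sub>0\<close>,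
    \<open>B\<^sub>0\<close>, \<open>C\<^sub>0\<close>, \<open>D\<^sub>0\<close> therefore
    characterises both Toeplitz conditions by the same equation.\<close>
  note disp = displacement_eq_iff
    [OF colc [OF cols(1)] zero(1) colc [OF cols(4)] zero(4)
      colc [OF cols(5)] zero(5) colc [OF cols(8)] zero(8),
      where \<Omega> = \<Omega> and B = B and \<Gamma> = \<Gamma> and D = D]
  note diags = has_diagonals_toep [OF \<A>]
  have toep_iff: "toep n d A \<Omega> * toep n d B \<Lambda> - toep n d C \<Gamma> * toep n d D \<Theta> \<in> block_toeplitz n d \<A> \<longleftrightarrow>
      A * mat_adjoint \<Lambda> - tilde n d \<Omega> * mat_adjoint (tilde n d B) =
      C * mat_adjoint \<Theta> - tilde n d \<Gamma> * mat_adjoint (tilde n d D)"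
    unfolding disp [where W = "0\<^sub>m d d" and X = "0\<^sub>m d d" and Y = "0\<^sub>m d d" and Z = "0\<^sub>m d d"]
    by (rule mult_minus_mult_block_toeplitz_iff
        [OF \<A> diags [OF cols(1,2)] diags [OF cols(3,4)] diags [OF cols(5,6)] diags [OF cols(7,8)]])
  obtain W where W: "has_diagonals n d \<A> (diagonals d A \<Omega> W) \<AA>"
    unfolding assms(7) by (rule has_diagonals_toep_add [OF \<A> cols(1,2) diag(1)])
  obtain X where X: "has_diagonals n d \<A> (diagonals d B \<Lambda> X) \<BB>"
    unfolding assms(8) by (rule has_diagonals_toep_add [OF \<A> cols(3,4) diag(2)])
  obtain Y where Y: "has_diagonals n d \<A> (diagonals d C \<Gamma> Y) \<CC>"
    unfolding assms(9) by (rule has_diagonals_toep_add [OF \<A> cols(5,6) diag(3)])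
  obtain Z where Z: "has_diagonals n d \<A> (diagonals d D \<Theta> Z) \<DD>"
    unfolding assms(10) by (rule has_diagonals_toep_add [OF \<A> cols(7,8) diag(4)])
  have full_iff: "\<AA> * \<BB> - \<CC> * \<DD> \<in> block_toeplitz n d \<A> \<longleftrightarrow>
      A * mat_adjoint \<Lambda> - tilde n d \<Omega> * mat_adjoint (tilde n d B) =
      C * mat_adjoint \<Theta> - tilde n d \<Gamma> * mat_adjoint (tilde n d D)"
    unfolding disp [where W = W and X = X and Y = Y and Z = Z]
    by (rule mult_minus_mult_block_toeplitz_iff [OF \<A> W X Y Z])
  let ?P = "mat_adjoint (P0 n d)"
  have car: "\<AA> * \<BB> \<in> carrier_mat (n * d) (n * d)" "\<CC> * \<DD> \<in> carrier_mat (n * d) (n * d)"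
    using W X Y Z by (auto simp: has_diagonals_def)
  \<comment> \<open>By linearity, the vanishing of the first block column and row of the difference
    becomes an equality of those of the two products, which are then evaluated one by one.\<close>
  have "\<AA> * \<BB> - \<CC> * \<DD> = 0\<^sub>m (n * d) (n * d) \<longleftrightarrow>
      \<AA> * \<BB> * ?P = \<CC> * \<DD> * ?P \<and>
      mat_adjoint (\<AA> * \<BB>) * ?P = mat_adjoint (\<CC> * \<DD>) * ?P"
    if "\<AA> * \<BB> - \<CC> * \<DD> \<in> block_toeplitz n d \<A>"
  proof -
    have "(\<AA> * \<BB> - \<CC> * \<DD>) * ?P = \<AA> * \<BB> * ?P - \<CC> * \<DD> * ?P"
      by (rule minus_mult_distrib_mat [OF car mat_adjoint_P0_carrier])
    moreover have "mat_adjoint (\<AA> * \<BB> - \<CC> * \<DD>) * ?P =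
        mat_adjoint (\<AA> * \<BB>) * ?P - mat_adjoint (\<CC> * \<DD>) * ?P"
      unfolding mat_adjoint_minus [OF car]
      by (rule minus_mult_distrib_mat [OF car [THEN mat_adjoint_carrier] mat_adjoint_P0_carrier])
    moreover have "\<AA> * \<BB> * ?P \<in> carrier_mat (n * d) d" "\<CC> * \<DD> * ?P \<in> carrier_mat (n * d) d"
        "mat_adjoint (\<AA> * \<BB>) * ?P \<in> carrier_mat (n * d) d"
        "mat_adjoint (\<CC> * \<DD>) * ?P \<in> carrier_mat (n * d) d"
      using mult_carrier_mat [OF car(1)] mult_carrier_mat [OF car(2)]
        mult_carrier_mat [OF mat_adjoint_carrier [OF car(1)]]
        mult_carrier_mat [OF mat_adjoint_carrier [OF car(2)]] by simp_all
    ultimately show ?thesis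
      using block_toeplitz_eq_zero_iff [OF that] by (simp add: minus_mat_eq_zero_iff)
  qed
  moreover have "\<AA> * \<BB> * ?P = \<AA> * B + B\<^sub>0 * A + A\<^sub>0 * B\<^sub>0 * ?P"
    unfolding assms(7,8) by (intro first_column_mult [OF \<A>] cols zero diag)
  moreover have "\<CC> * \<DD> * ?P = \<CC> * D + D\<^sub>0 * C + C\<^sub>0 * D\<^sub>0 * ?P"
    unfolding assms(9,10) by (intro first_column_mult [OF \<A>] cols zero diag)
  moreover have "mat_adjoint (\<AA> * \<BB>) * ?P =
      mat_adjoint \<BB> * \<Omega> + mat_adjoint A\<^sub>0 * \<Lambda> + mat_adjoint A\<^sub>0 * mat_adjoint B\<^sub>0 * ?P"
    unfolding assms(7,8) by (intro first_row_mult [OF \<A>] cols zero diag)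
  moreover have "mat_adjoint (\<CC> * \<DD>) * ?P =
      mat_adjoint \<DD> * \<Gamma> + mat_adjoint C\<^sub>0 * \<Theta> + mat_adjoint C\<^sub>0 * mat_adjoint D\<^sub>0 * ?P"
    unfolding assms(9,10) by (intro first_row_mult [OF \<A>] cols zero diag)
  ultimately show ?thesis
    using toep_iff full_iff by simp
qed

end
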